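(* There exists a strongly regular graph with parameters $(144,52,16,20)$, and there exists a strongly regular graph with parameters $(147,66,25,33)$.
   Context: A finite simple graph on $n$ vertices is strongly regular with parameters $(n,k,\lambda,\mu)$ if every vertex has degree $k$, every pair of distinct adjacent vertices has exactly $\lambda$ common neighbors, and every pair of distinct non-adjacent vertices has exactly $\mu$ common neighbors. *)

theory Defs
  imports Main
begin

definition simple_graph :: "'a set \<Rightarrow> ('a \<Rightarrow> 'a \<Rightarrow> bool) \<Rightarrow> bool" where
  "simple_graph V E \<longleftrightarrow> finite V \<and>
     (\<forall>x y. E x y \<longrightarrow> x \<in> V \<and> y \<in> V) \<and>
     (\<forall>x y. E x y \<longrightarrow> E y x) \<and>
     (\<forall>x. \<not> E x x)"

definition neighbors :: "'a set \<Rightarrow> ('a \<Rightarrow> 'a \<Rightarrow> bool) \<Rightarrow> 'a \<Rightarrow> 'a set" where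
  "neighbors V E x = {y \<in> V. E x y}"

definition strongly_regular ::
  "'a set \<Rightarrow> ('a \<Rightarrow> 'a \<Rightarrow> bool) \<Rightarrow> nat \<Rightarrow> nat \<Rightarrow> nat \<Rightarrow> nat \<Rightarrow> bool" where
  "strongly_regular V E n k lam mu \<longleftrightarrow>
     simple_graph V E \<and> card V = n \<and>
     (\<forall>x\<in>V. card (neighbors V E x) = k) \<and>
     (\<forall>x\<in>V. \<forall>y\<in>V. x \<noteq> y \<longrightarrow> E x y \<longrightarrow>
        card (neighbors V E x \<inter> neighbors V E y) = lam) \<and>
     (\<forall>x\<in>V. \<forall>y\<in>V. x \<noteq> y \<longrightarrow> \<not> E x y \<longrightarrow>
        card (neighbors V E x \<inter> neighbors V E y) = mu)"

end

theory Submission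
  imports Defs "HOL-Algebra.Coset"
begin

text \<open>
  Both graphs are Cayley graphs of partial difference sets in nonabelian groups that act regularly
  on the vertices, so common neighbours need only be counted for pairs containing the identity.
\<close>

section \<open>Partial difference sets\<close>

text \<open>
  Since \<open>D\<close> is closed under inversion, the number of representations \<open>g = s \<otimes> t\<close> with
  \<open>s, t \<in> D\<close> is \<open>card {s \<in> D. g \<otimes> s \<in> D}\<close>; this form avoids computing inverses.
\<close>

definition partial_difference_set ::
  "('a, 'b) monoid_scheme \<Rightarrow> 'a set \<Rightarrow> nat \<Rightarrow> nat \<Rightarrow> nat \<Rightarrow> bool" where
  "partial_difference_set G D k lam mu \<longleftrightarrow>
     D \<subseteq> carrier G \<and> \<one>\<^bsub>G\<^esub> \<notin> D \<and> (\<forall>s\<in>D. inv\<^bsub>G\<^esub> s \<in> D) \<and> card D = k \<and>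
     (\<forall>g\<in>carrier G - {\<one>\<^bsub>G\<^esub>}. card {s \<in> D. g \<otimes>\<^bsub>G\<^esub> s \<in> D} = (if g \<in> D then lam else mu))"

definition cayley_graph :: "('a, 'b) monoid_scheme \<Rightarrow> 'a set \<Rightarrow> 'a \<Rightarrow> 'a \<Rightarrow> bool" where
  "cayley_graph G D x y \<longleftrightarrow> x \<in> carrier G \<and> y \<in> carrier G \<and> inv\<^bsub>G\<^esub> x \<otimes>\<^bsub>G\<^esub> y \<in> D"

lemma (in group) neighbors_cayley_graph:
  assumes "D \<subseteq> carrier G" "x \<in> carrier G"
  shows "neighbors (carrier G) (cayley_graph G D) x = (\<lambda>s. x \<otimes> s) ` D"
proof (intro equalityI subsetI)
  fix y assume "y \<in> neighbors (carrier G) (cayley_graph G D) x"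
  then have "y \<in> carrier G" "inv x \<otimes> y \<in> D"
    by (auto simp: neighbors_def cayley_graph_def)
  moreover from this have "y = x \<otimes> (inv x \<otimes> y)"
    using assms by (simp add: m_assoc [symmetric])
  ultimately show "y \<in> (\<lambda>s. x \<otimes> s) ` D" by blast
next
  fix y assume "y \<in> (\<lambda>s. x \<otimes> s) ` D"
  then obtain s where "s \<in> D" "y = x \<otimes> s" by blast
  then show "y \<in> neighbors (carrier G) (cayley_graph G D) x"
    using assms by (auto simp: neighbors_def cayley_graph_def m_assoc [symmetric])
qed

lemma (in group) strongly_regular_cayley_graph:
  assumes "finite (carrier G)" and pds: "partial_difference_set G D k lam mu"
  shows "strongly_regular (carrier G) (cayley_graph G D) (order G) k lam mu"
proof -
  let ?V = "carrier G" and ?E = "cayley_graph G D"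
  have sub: "D \<subseteq> ?V" and one: "\<one> \<notin> D" and inv: "\<And>s. s \<in> D \<Longrightarrow> inv s \<in> D"
    and card: "card D = k"
    and count: "\<And>g. g \<in> ?V \<Longrightarrow> g \<noteq> \<one> \<Longrightarrow>
      card {s \<in> D. g \<otimes> s \<in> D} = (if g \<in> D then lam else mu)"
    using pds by (auto simp: partial_difference_set_def)
  have sym: "?E y x" if "?E x y" for x y
    using that inv [of "inv x \<otimes> y"] by (auto simp: cayley_graph_def inv_mult_group)
  have degree: "card (neighbors ?V ?E x) = k" if "x \<in> ?V" for x
  proof -
    have "inj_on (\<lambda>s. x \<otimes> s) D"
      using that sub by (intro inj_onI) (metis Units_eq Units_l_cancel subsetD)
    then show ?thesis
      by (simp add: neighbors_cayley_graph [OF sub that] card_image card)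
  qed
  have common: "card (neighbors ?V ?E x \<inter> neighbors ?V ?E y) = (if ?E x y then lam else mu)"
    if "x \<in> ?V" "y \<in> ?V" "x \<noteq> y" for x y
  proof -
    \<comment> \<open>Left translation by \<open>inv y\<close> carries the pair \<open>x\<close>,
      \<open>y\<close> to \<open>g\<close>, \<open>\<one>\<close>, and a common neighbour
      \<open>x \<otimes> s = y \<otimes> t\<close> amounts to \<open>g \<otimes> s = t\<close> with
      \<open>s\<close> and \<open>t\<close> in \<open>D\<close>.\<close>
    define g where "g = inv y \<otimes> x"
    have g: "g \<in> ?V" and x: "x = y \<otimes> g"
      using that by (simp_all add: g_def m_assoc [symmetric])
    then have "g \<noteq> \<one>" using that by auto
    have "neighbors ?V ?E x \<inter> neighbors ?V ?E y = (\<lambda>s. x \<otimes> s) ` {s \<in> D. g \<otimes> s \<in> D}"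
    proof -
      have "x \<otimes> s \<in> (\<lambda>s. y \<otimes> s) ` D \<longleftrightarrow> g \<otimes> s \<in> D" if "s \<in> D" for s
      proof -
        have "x \<otimes> s = y \<otimes> (g \<otimes> s)"
          using \<open>s \<in> D\<close> sub g \<open>y \<in> ?V\<close> by (auto simp: x m_assoc)
        moreover have "y \<otimes> (g \<otimes> s) = y \<otimes> t \<longleftrightarrow> g \<otimes> s = t" if "t \<in> D" for t
          using \<open>s \<in> D\<close> \<open>t \<in> D\<close> sub g \<open>y \<in> ?V\<close> by (intro Units_l_cancel) auto
        ultimately show ?thesis by (auto simp: image_iff)
      qed
      then show ?thesis
        using that by (auto simp: neighbors_cayley_graph [OF sub])
    qed
    moreover have "inj_on (\<lambda>s. x \<otimes> s) {s \<in> D. g \<otimes> s \<in> D}"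
      using that sub by (intro inj_onI) (metis (lifting) Units_eq Units_l_cancel mem_Collect_eq subsetD)
    \<comment> \<open>\<open>g \<in> D\<close> literally says \<open>?E y x\<close>, hence the
      appeal to symmetry.\<close>
    moreover have "g \<in> D \<longleftrightarrow> ?E x y"
      using that sym [of x y] sym [of y x] by (auto simp: g_def cayley_graph_def)
    ultimately show ?thesis
      by (simp add: card_image count [OF g \<open>g \<noteq> \<one>\<close>])
  qed
  have "simple_graph ?V ?E"
    unfolding simple_graph_def using assms(1) sym one
    by (auto simp: cayley_graph_def)
  then show ?thesis
    by (simp add: strongly_regular_def order_def degree common)
qed

text \<open>The groups below consist of integer tuples, while the theorem asks for natural numbers
  as vertices; an injection transports the finite graph.\<close>

lemma strongly_regular_nat:
  assumes "strongly_regular V E n k lam mu"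
  shows "\<exists>(W :: nat set) F. strongly_regular W F n k lam mu"
proof -
  have fin: "finite V" and EV: "\<And>x y. E x y \<Longrightarrow> x \<in> V \<and> y \<in> V"
    and sym: "\<And>x y. E x y \<Longrightarrow> E y x"
    using assms by (auto simp: strongly_regular_def simple_graph_def)
  then obtain f :: "_ \<Rightarrow> nat" where inj: "inj_on f V"
    using finite_imp_inj_to_nat_seg by metis
  define F where "F i j \<longleftrightarrow> (\<exists>x y. i = f x \<and> j = f y \<and> E x y)" for i j
  have F: "F (f x) (f y) \<longleftrightarrow> E x y" if "x \<in> V" "y \<in> V" for x y
    unfolding F_def using that EV inj by (metis inj_onD)
  have neighbors: "neighbors (f ` V) F (f x) = f ` neighbors V E x" if "x \<in> V" for x
    using that F by (auto simp: neighbors_def)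
  have sub: "neighbors V E x \<subseteq> V" for x
    by (auto simp: neighbors_def)
  have card: "card (f ` A) = card A" if "A \<subseteq> V" for A
    using card_image inj inj_on_subset that by blast
  have "simple_graph (f ` V) F"
    unfolding simple_graph_def
  proof (intro conjI allI impI)
    show "finite (f ` V)" using fin by simp
    show "i \<in> f ` V" "j \<in> f ` V" if "F i j" for i j
      using that EV by (auto simp: F_def)
    show "F j i" if "F i j" for i j
      using that sym unfolding F_def by blast
    show "\<not> F i i" for i
    proof
      assume "F i i"
      then obtain x y where "E x y" "f x = f y" by (auto simp: F_def)
      then have "E x x" using EV inj by (metis inj_onD)
      then show False using assms by (auto simp: strongly_regular_def simple_graph_def)
    qed
  qed
  then have "strongly_regular (f ` V) F n k lam mu"
    using assms inj sub
    by (auto simp: strongly_regular_def neighbors F card inj_on_image_Int [symmetric] le_infI1)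
  then show ?thesis by blast
qed

text \<open>
  The elements of the set are passed separately as \<open>ds\<close>, so that evaluation computes this list
  only once, before the quantifiers are unfolded.
\<close>

definition difference_count ::
  "('a \<Rightarrow> 'a \<Rightarrow> 'a) \<Rightarrow> 'a \<Rightarrow> ('a \<Rightarrow> bool) \<Rightarrow> 'a list \<Rightarrow> 'a list \<Rightarrow> nat \<Rightarrow> nat \<Rightarrow> nat \<Rightarrow> bool" where
  "difference_count f e P xs ds k lam mu \<longleftrightarrow>
     \<not> P e \<and> length ds = k \<and> (\<forall>s\<in>set ds. \<exists>t\<in>set ds. f s t = e) \<and>
     (\<forall>g\<in>set xs. g = e \<or> length (filter (\<lambda>s. P (f g s)) ds) = (if P g then lam else mu))"

lemma (in group) partial_difference_set_enum:
  assumes xs: "carrier G = set xs" "distinct xs"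
    and count: "difference_count (\<otimes>) \<one> P xs (filter P xs) k lam mu"
  shows "partial_difference_set G {x \<in> carrier G. P x} k lam mu"
  unfolding partial_difference_set_def
proof (intro conjI ballI)
  let ?D = "{x \<in> carrier G. P x}"
  have D: "?D = set (filter P xs)" using xs by simp
  show "?D \<subseteq> carrier G" by blast
  show "\<one> \<notin> ?D" using count by (simp add: difference_count_def)
  show "card ?D = k"
    unfolding D using count xs by (simp add: difference_count_def distinct_card del: set_filter)
  show "inv s \<in> ?D" if "s \<in> ?D" for s
  proof -
    have "\<forall>s\<in>?D. \<exists>t\<in>?D. s \<otimes> t = \<one>"
      using count unfolding D difference_count_def by (elim conjE)
    then obtain t where t: "t \<in> ?D" "s \<otimes> t = \<one>"
      using \<open>s \<in> ?D\<close> by meson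
    \<comment> \<open>In a group a right inverse is the inverse, so finding \<open>t\<close> by
      search in the list is enough.\<close>
    then have "inv s = t"
      using that by (intro inv_equality inv_comm [of s t]) auto
    then show ?thesis using t by simp
  qed
  fix g assume g: "g \<in> carrier G - {\<one>}"
  have "{s \<in> ?D. g \<otimes> s \<in> ?D} = set (filter (\<lambda>s. P (g \<otimes> s)) (filter P xs))"
    using g xs by auto
  then have "card {s \<in> ?D. g \<otimes> s \<in> ?D} = length (filter (\<lambda>s. P (g \<otimes> s)) (filter P xs))"
    using xs by (metis distinct_card distinct_filter)
  then show "card {s \<in> ?D. g \<otimes> s \<in> ?D} = (if g \<in> ?D then lam else mu)"
    using g count xs by (auto simp: difference_count_def)
qed

lemma (in group) strongly_regular_nat_enum:
  assumes "carrier G = set xs" "distinct xs"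
    and "difference_count (\<otimes>) \<one> P xs (filter P xs) k lam mu"
  shows "\<exists>(V :: nat set) E. strongly_regular V E (length xs) k lam mu"
  using strongly_regular_nat [OF strongly_regular_cayley_graph
      [OF _ partial_difference_set_enum [OF assms]]] assms
  by (simp add: order_def distinct_card)


section \<open>A group of order 147\<close>

text \<open>Associativity in one cyclic coordinate of a semidirect product: \<open>t\<close>,
  \<open>t'\<close> and \<open>t''\<close> are the multipliers by which two elements and their
  product act.\<close>

lemma mod_semidirect_assoc:
  fixes a a' a'' t t' t'' m :: int
  assumes "t'' mod m = (t * t') mod m"
  shows "((a + t * a') mod m + t'' * a'') mod m = (a + t * ((a' + t' * a'') mod m)) mod m"
proof -
  have "(t'' * a'') mod m = (t * t' * a'') mod m"
    using assms by (metis mod_mult_left_eq)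
  then have "(a + t * a' + t'' * a'') mod m = (a + t * a' + t * t' * a'') mod m"
    by (metis mod_add_right_eq)
  moreover have "(a + t * ((a' + t' * a'') mod m)) mod m = (a + t * (a' + t' * a'')) mod m"
    by (metis mod_add_right_eq mod_mult_right_eq)
  ultimately show ?thesis
    by (simp add: mod_add_left_eq distrib_left mult.assoc add.assoc)
qed

lemma mod_add_assoc: "((a + b) mod m + c) mod m = (a + (b + c) mod m) mod m" for a b c m :: int
  by (simp add: mod_simps add.assoc)

text \<open>
  The semidirect product of \<open>\<int>\<^sub>7\<^sup>2\<close> with \<open>\<int>\<^sub>3\<close>, the generator of the latter acting as
  multiplication by 2.
\<close>

definition scale147 :: "int \<Rightarrow> int" where
  "scale147 c = (if c = 0 then 1 else if c = 1 then 2 else 4)"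

fun mult147 :: "int \<times> int \<times> int \<Rightarrow> int \<times> int \<times> int \<Rightarrow> int \<times> int \<times> int" where
  "mult147 (a, b, c) (a', b', c') =
     ((a + scale147 c * a') mod 7, (b + scale147 c * b') mod 7, (c + c') mod 3)"

definition elements147 :: "(int \<times> int \<times> int) list" where
  "elements147 = List.product [0..6] (List.product [0..6] [0..2])"

definition group147 :: "(int \<times> int \<times> int) monoid" where
  "group147 = \<lparr>carrier = set elements147, mult = mult147, one = (0, 0, 0)\<rparr>"

text \<open>Row \<open>a\<close> of block \<open>c\<close> lists the \<open>b\<close> with \<open>(a, b, c)\<close> in the set, which was found by computer search.\<close>

definition table147 :: "int list list list" where
  "table147 =
     [
      [[1,6], [0,1,3,5], [0,1,2,4,5], [0,3], [0,4], [0,2,3,5,6], [0,2,4,6]],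
      [[2,5,6], [2], [1,2,4,6], [0,1,3,5,6], [0,3,4,5], [1], [0,3,4]],
      [[1,4,6], [3], [0,1,2,3,4], [6], [0,2,5], [0,1,2,5], [3,4,5,6]]]"

fun pds147 :: "int \<times> int \<times> int \<Rightarrow> bool" where
  "pds147 (a, b, c) \<longleftrightarrow> b \<in> set (table147 ! nat c ! nat a)"

lemma set_elements147: "set elements147 = {0..<7} \<times> {0..<7} \<times> {0..<3}"
  by (auto simp: elements147_def)

text \<open>2 has order 3 modulo 7, so its powers give a homomorphism from the integers modulo 3 to
  the units modulo 7.\<close>

lemma scale147_add:
  assumes "c \<in> {0..<3}" "c' \<in> {0..<3}"
  shows "scale147 ((c + c') mod 3) mod 7 = (scale147 c * scale147 c') mod 7"
proof -
  have "c = 0 \<or> c = 1 \<or> c = 2" "c' = 0 \<or> c' = 1 \<or> c' = 2"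
    using assms by auto
  then show ?thesis by (auto simp: scale147_def)
qed

lemma group_group147: "group group147"
proof (rule groupI; unfold group147_def monoid.simps partial_object.simps set_elements147)
  fix x y z :: "int \<times> int \<times> int"
  let ?V = "{0..<7} \<times> {0..<7} \<times> {0..<3} :: (int \<times> int \<times> int) set"
  show "(0, 0, 0) \<in> ?V" by simp
  assume x: "x \<in> ?V"
  show "mult147 (0, 0, 0) x = x"
    using x by (auto simp: scale147_def)
  obtain a b c where abc: "x = (a, b, c)" "c \<in> {0..<3}" using x by auto
  show "\<exists>y\<in>?V. mult147 y x = (0, 0, 0)"
  proof
    \<comment> \<open>A left inverse must have last coordinate \<open>- c mod 3\<close>; its
      multiplier \<open>t\<close> then determines the other two.\<close>
    define t where "t = scale147 (- c mod 3)"
    show "mult147 (- t * a mod 7, - t * b mod 7, - c mod 3) x = (0, 0, 0)"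
      by (simp add: abc t_def [symmetric] mod_simps)
    show "(- t * a mod 7, - t * b mod 7, - c mod 3) \<in> ?V" by simp
  qed
  assume y: "y \<in> ?V"
  show "mult147 x y \<in> ?V" by (cases x; cases y) simp
  assume "z \<in> ?V"
  then show "mult147 (mult147 x y) z = mult147 x (mult147 y z)"
    using x y by (auto simp: mod_semidirect_assoc [OF scale147_add] mod_add_assoc [where m = 3])
qed

lemma difference_count147:
  "difference_count mult147 (0, 0, 0) pds147 elements147 (filter pds147 elements147) 66 25 33"
  by code_simp

lemma ex_srg147: "\<exists>(V :: nat set) E. strongly_regular V E 147 66 25 33"
proof -
  interpret group group147 by (rule group_group147)
  have "length elements147 = 147" "distinct elements147"
    by (simp_all add: elements147_def distinct_product upto.simps)
  then show ?thesis
    using strongly_regular_nat_enum [of elements147 pds147 66 25 33] difference_count147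
    by (simp add: group147_def)
qed


section \<open>A group of order 144\<close>

text \<open>
  The semidirect product of \<open>\<int>\<^sub>2\<^sup>2\<close> with the semidirect product of \<open>\<int>\<^sub>3\<^sup>2\<close> with \<open>\<int>\<^sub>4\<close>. The
  generator of \<open>\<int>\<^sub>4\<close> inverts \<open>\<int>\<^sub>3\<^sup>2\<close>; on \<open>\<int>\<^sub>2\<^sup>2\<close>, the first generator of \<open>\<int>\<^sub>3\<^sup>2\<close> permutes
  \<open>(1, 0), (0, 1), (1, 1)\<close> cyclically, the second acts trivially, and that of \<open>\<int>\<^sub>4\<close> swaps \<open>(0, 1)\<close>
  and \<open>(1, 1)\<close>.
\<close>

fun act144 :: "int \<Rightarrow> int \<Rightarrow> int \<times> int \<Rightarrow> int \<times> int" where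
  "act144 a i (p, q) =
     (if a = 0 then (p + i * q, q) else if a = 1 then (q, p + i * q + q) else (p + i * q + q, p + i * q))"

definition sign144 :: "int \<Rightarrow> int" where
  "sign144 i = (if even i then 1 else - 1)"

type_synonym element144 = "(int \<times> int) \<times> int \<times> int \<times> int"

fun mult144 :: "element144 \<Rightarrow> element144 \<Rightarrow> element144" where
  "mult144 ((p, q), a, b, i) (v, a', b', i') =
     (case act144 a i v of (p', q') \<Rightarrow>
       (((p + p') mod 2, (q + q') mod 2),
        (a + sign144 i * a') mod 3, (b + sign144 i * b') mod 3, (i + i') mod 4))"

definition elements144 :: "element144 list" where
  "elements144 =
     List.product (List.product [0..1] [0..1]) (List.product [0..2] (List.product [0..2] [0..3]))"

definition group144 :: "element144 monoid" where
  "group144 = \<lparr>carrier = set elements144, mult = mult144, one = ((0, 0), 0, 0, 0)\<rparr>"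

text \<open>
  Entry \<open>b\<close> of row \<open>a\<close> of block \<open>i\<close> lists the \<open>p + 2 * q\<close> with \<open>((p, q), a, b, i)\<close> in the set,
  which was found by computer search.
\<close>

definition table144 :: "int list list list list" where
  "table144 =
     [
      [[[], [0,1,2,3], [0,1,2,3]],  [[2], [0,2], [3]],  [[1], [2], [0,1]]],
      [[[], [0,3], [0,3]],  [[1], [0,1], [3]],  [[2], [1], [2,3]]],
      [[[0,1,2,3], [], []],  [[0], [0,1], [2]],  [[0], [1], [0,3]]],
      [[[], [0,2], [0,2]],  [[2], [0,2], [3]],  [[2], [3], [1,2]]]]"

fun pds144 :: "element144 \<Rightarrow> bool" where
  "pds144 ((p, q), a, b, i) \<longleftrightarrow> p + 2 * q \<in> set (table144 ! nat i ! nat a ! nat b)"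

lemma set_elements144:
  "set elements144 = ({0..<2} \<times> {0..<2}) \<times> {0..<3} \<times> {0..<3} \<times> {0..<4}"
  by (auto simp: elements144_def)

lemma sign144_add: "sign144 ((i + i') mod 4) mod 3 = (sign144 i * sign144 i') mod 3"
proof -
  have "even ((i + i') mod 4) \<longleftrightarrow> (even i \<longleftrightarrow> even i')" by presburger
  then show ?thesis by (auto simp: sign144_def)
qed

lemma int_mod_2_eq_iff: "x mod 2 = y mod 2 \<longleftrightarrow> (even x \<longleftrightarrow> even y)" for x y :: int
  by presburger

text \<open>Combines additivity of the action with its compatibility with the group product. Modulo
  2 the maps form GL(2,2), a copy of S_3, where an involution inverts the 3-cycle; this is the sign
  twist in the product. Only parities are compared, since \<open>act144\<close> does not reduce
  modulo 2.\<close>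

lemma even_act144:
  assumes "a \<in> {0..<3}" "a' \<in> {0..<3}"
    and "act144 a i (p, q) = (p1, q1)" "act144 a' i' (r, s) = (r1, s1)"
    and "act144 ((a + sign144 i * a') mod 3) ((i + i') mod 4) (r, s) = (r2, s2)"
    and "act144 a i ((p + r1) mod 2, (q + s1) mod 2) = (p3, q3)"
  shows "even p3 \<longleftrightarrow> even (p1 + r2)" "even q3 \<longleftrightarrow> even (q1 + s2)"
proof -
  have parity: "even ((i + i') mod 4) \<longleftrightarrow> (even i \<longleftrightarrow> even i')" by presburger
  have "a = 0 \<or> a = 1 \<or> a = 2" "a' = 0 \<or> a' = 1 \<or> a' = 2"
    using assms(1,2) by auto
  then have "(even p3 \<longleftrightarrow> even (p1 + r2)) \<and> (even q3 \<longleftrightarrow> even (q1 + s2))"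
    \<comment> \<open>Once \<open>a\<close>, \<open>a'\<close> and the parity of \<open>i\<close>
      are fixed, propositional identities between parities remain.\<close>
    using assms(3-) by (elim disjE; cases "even i") (clarsimp simp: sign144_def parity; argo)+
  then show "even p3 \<longleftrightarrow> even (p1 + r2)" "even q3 \<longleftrightarrow> even (q1 + s2)" by auto
qed

lemma group_group144: "group group144"
proof (rule groupI; unfold group144_def monoid.simps partial_object.simps set_elements144)
  fix x y z :: element144
  let ?V = "({0..<2} \<times> {0..<2}) \<times> {0..<3} \<times> {0..<3} \<times> {0..<4} :: element144 set"
  show "((0, 0), 0, 0, 0) \<in> ?V" by simp
  assume x: "x \<in> ?V"
  show "mult144 ((0, 0), 0, 0, 0) x = x"
    using x by (auto simp: sign144_def)
  obtain p q a b i where abc: "x = ((p, q), a, b, i)" using x by auto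
  \<comment> \<open>The left inverse is solved from the last coordinate backwards: \<open>j\<close>
    fixes \<open>c\<close> and \<open>d\<close>, and these fix the action on
    \<open>(p, q)\<close>.\<close>
  define j where "j = - i mod 4"
  define c where "c = - sign144 j * a mod 3"
  define d where "d = - sign144 j * b mod 3"
  obtain u w where v: "act144 c j (p, q) = (u, w)" by fastforce
  have "(j + i) mod 4 = 0" "(c + sign144 j * a) mod 3 = 0" "(d + sign144 j * b) mod 3 = 0"
    by (simp_all add: j_def c_def d_def mod_simps)
  then have "mult144 ((- u mod 2, - w mod 2), c, d, j) x = ((0, 0), 0, 0, 0)"
    by (simp add: abc v mod_simps del: act144.simps)
  moreover have "((- u mod 2, - w mod 2), c, d, j) \<in> ?V" by (simp add: j_def c_def d_def)
  ultimately show "\<exists>y\<in>?V. mult144 y x = ((0, 0), 0, 0, 0)" by blast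
  assume y: "y \<in> ?V"
  show "mult144 x y \<in> ?V" by (cases x; cases y) (auto split: prod.split)
  assume "z \<in> ?V"
  obtain p' q' a' b' i' where y': "y = ((p', q'), a', b', i')" using y by auto
  obtain r s a'' b'' i'' where z': "z = ((r, s), a'', b'', i'')" by (cases z) auto
  \<comment> \<open>These are the values of the action in the two bracketings:
    \<open>(p1, q1)\<close> and \<open>(r2, s2)\<close> arise on the left, \<open>(r1, s1)\<close>
    and \<open>(p3, q3)\<close> on the right.\<close>
  obtain p1 q1 where 1: "act144 a i (p', q') = (p1, q1)" by fastforce
  obtain r1 s1 where 2: "act144 a' i' (r, s) = (r1, s1)" by fastforce
  obtain r2 s2 where 3: "act144 ((a + sign144 i * a') mod 3) ((i + i') mod 4) (r, s) = (r2, s2)"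
    by fastforce
  obtain p3 q3 where 4: "act144 a i ((p' + r1) mod 2, (q' + s1) mod 2) = (p3, q3)" by fastforce
  have "a \<in> {0..<3}" "a' \<in> {0..<3}" using x y by (simp_all add: abc y')
  note even_act144 [OF this 1 2 3 4]
  then have mod_2: "((p + p1) mod 2 + r2) mod 2 = (p + p3) mod 2" "((q + q1) mod 2 + s2) mod 2 = (q + q3) mod 2"
    by (simp_all add: int_mod_2_eq_iff) argo+
  show "mult144 (mult144 x y) z = mult144 x (mult144 y z)"
    by (simp only: abc y' z' mult144.simps 1 2 3 4 prod.case mod_2
        mod_semidirect_assoc [OF sign144_add] mod_add_assoc [where m = 4])
qed

lemma difference_count144:
  "difference_count mult144 ((0, 0), 0, 0, 0) pds144 elements144 (filter pds144 elements144) 52 16 20"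
  by code_simp

lemma ex_srg144: "\<exists>(V :: nat set) E. strongly_regular V E 144 52 16 20"
proof -
  interpret group group144 by (rule group_group144)
  have "length elements144 = 144" "distinct elements144"
    by (simp_all add: elements144_def distinct_product upto.simps)
  then show ?thesis
    using strongly_regular_nat_enum [of elements144 pds144 52 16 20] difference_count144
    by (simp add: group144_def)
qed

theorem theorem1:
  shows "(\<exists>(V :: nat set) E. strongly_regular V E 144 52 16 20) \<and>
         (\<exists>(V :: nat set) E. strongly_regular V E 147 66 25 33)"
  using ex_srg144 ex_srg147 ..

end
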